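(* Let $a<b$ be real numbers and let $P$ be the uniform distribution on the closed interval $[a,b]$. Then the quantization dimension of $P$ exists and equals the dimension of the line segment, $$D(P)=\lim_{n\to\infty}\frac{2\log n}{-\log V_n(P)}=1,$$ and moreover $$\lim_{n\to\infty}n^2V_n(P)=\frac{(a-b)^2}{12},$$ which is a finite positive number.
   Context: The uniform distribution $P$ on $[a,b]$ is the Borel probability measure on $\mathbb{R}$ with density $f(x)=\frac{1}{b-a}$ for $x\in[a,b]$ and $f(x)=0$ otherwise. For a Borel probability measure $P$ on $\mathbb{R}^d$ (here $d=1$) with $\int\|x\|^2dP(x)<\infty$ and a nonempty finite set $\alpha\subset\mathbb{R}^d$, put $V(P;\alpha)=\int\min_{c\in\alpha}\|x-c\|^2\,dP(x)$. The $n$th quantization error is $V_n(P)=\inf\{V(P;\alpha):\alpha\subset\mathbb{R}^d,\ 1\le\operatorname{card}(\alpha)\leq n\}$. The lower and upper quantization dimensions are the $\liminf$ and $\limsup$ as $n\to\infty$ of $\frac{2\log n}{-\log V_n(P)}$; if they are equal, the common value is the quantization dimension $D(P)$. *)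

theory Defs
  imports "HOL-Probability.Probability"
begin

definition uniform_interval :: "real \<Rightarrow> real \<Rightarrow> real measure" where
  "uniform_interval a b =
     density lborel (\<lambda>x. ennreal (if x \<in> {a..b} then 1 / (b - a) else 0))"

lemma sets_uniform_interval [simp]: "sets (uniform_interval a b) = sets borel"
  by (simp add: uniform_interval_def)

lemma prob_space_uniform_interval:
  assumes "a < b"
  shows "prob_space (uniform_interval a b)"
proof
  have "emeasure (uniform_interval a b) (space (uniform_interval a b)) =
      (\<integral>\<^sup>+x. ennreal (1 / (b - a)) * indicator {a..b} x \<partial>lborel)"
    unfolding uniform_interval_def
    by (subst emeasure_density) (auto intro!: nn_integral_cong simp: indicator_def)
  also have "\<dots> = 1"
    using assms by (simp add: nn_integral_cmult_indicator ennreal_mult'[symmetric])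
  finally show "emeasure (uniform_interval a b) (space (uniform_interval a b)) = 1" .
qed

text \<open>
  The definitions below are meant for Borel probability measures with finite second moment.
  The integrand in \<open>distortion P A\<close> is then integrable for every nonempty finite set \<open>A\<close>,
  so that the Bochner integral is the true integral and not the default value 0.
\<close>

definition distortion :: "'a::euclidean_space measure \<Rightarrow> 'a set \<Rightarrow> real" where
  "distortion P A = (\<integral>x. (MIN c\<in>A. (norm (x - c))\<^sup>2) \<partial>P)"

text \<open>For \<open>n = 0\<close> the infimum is over the empty set and its value is irrelevant.\<close>

definition quantization_error :: "'a::euclidean_space measure \<Rightarrow> nat \<Rightarrow> real" where
  "quantization_error P n =
     Inf {distortion P A | A. finite A \<and> 1 \<le> card A \<and> card A \<le> n}"

text \<open>
  If the error is 0, then \<open>ln 0 = 0\<close> and division by 0 make the quotient 0, which agrees with the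
  convention that \<open>- log 0\<close> is infinite. If the error is 1, the quotient is 0 by default; since
  the errors tend to 0, this can affect only finitely many \<open>n\<close>.
\<close>

definition quantization_ratio :: "'a::euclidean_space measure \<Rightarrow> nat \<Rightarrow> real" where
  "quantization_ratio P n = 2 * ln (real n) / (- ln (quantization_error P n))"

definition lower_quantization_dimension :: "'a::euclidean_space measure \<Rightarrow> ereal" where
  "lower_quantization_dimension P = liminf (\<lambda>n. ereal (quantization_ratio P n))"

definition upper_quantization_dimension :: "'a::euclidean_space measure \<Rightarrow> ereal" where
  "upper_quantization_dimension P = limsup (\<lambda>n. ereal (quantization_ratio P n))"

definition quantization_dimension_exists :: "'a::euclidean_space measure \<Rightarrow> bool" where
  "quantization_dimension_exists P \<longleftrightarrow>
     lower_quantization_dimension P = upper_quantization_dimension P"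

text \<open>Meaningful only if \<open>quantization_dimension_exists P\<close> holds.\<close>

definition quantization_dimension :: "'a::euclidean_space measure \<Rightarrow> ereal" where
  "quantization_dimension P = lower_quantization_dimension P"

end

theory Submission
  imports Defs "HOL-Real_Asymp.Real_Asymp"
begin

text \<open>
  The error is computed exactly: \<open>V\<^sub>n = (b - a)\<^sup>2 / (12 n\<^sup>2)\<close> for every \<open>n \<ge> 1\<close>; both limits are then
  elementary asymptotics.

  Both inequalities come from one comparison, which avoids Voronoi cells and any optimisation over
  their lengths. Fix a radius \<open>\<delta>\<close> and put a parabolic cap \<open>(\<delta>\<^sup>2 - (x - c)\<^sup>2)\<^sup>+\<close> on each
  centre \<open>c\<close> of a finite set \<open>A\<close>. Since a maximum of nonnegative numbers is at most
  their sum,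
  \<open>min\<^sub>c (x - c)\<^sup>2 \<ge> \<delta>\<^sup>2 - \<Sum>\<^sub>c (\<delta>\<^sup>2 - (x - c)\<^sup>2)\<^sup>+\<close> for all \<open>x\<close>. Every cap has integral
  \<open>4 \<delta>\<^sup>3 / 3\<close> wherever its centre lies, so integration over \<open>[a, b]\<close> bounds the distortion from
  below by a function of \<open>card A\<close> and \<open>\<delta>\<close> only (\<open>integral_Min_ge\<close>), and
  \<open>\<delta> = (b - a) / (2 card A)\<close> maximises it. The comparison is an equality on \<open>[a, b]\<close> when
  the intervals \<open>[c - \<delta>, c + \<delta>]\<close> tile \<open>[a, b]\<close> (\<open>integral_Min_le\<close>), which happens for
  the \<open>n\<close> midpoints of the equal subdivision; hence these are optimal.
\<close>

section \<open>Parabolic caps\<close>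

text \<open>
  The positive part of \<open>\<delta>\<^sup>2 - (x - c)\<^sup>2\<close> for \<open>\<delta> \<ge> 0\<close>, written with an indicator instead of a maximum so
  that the fundamental theorem of calculus gives its integral directly.
\<close>
definition cap :: "real \<Rightarrow> real \<Rightarrow> real \<Rightarrow> real" where
  "cap \<delta> c x = indicator {c - \<delta>..c + \<delta>} x * (\<delta>\<^sup>2 - (x - c)\<^sup>2)"

lemma cap_eq_0: "\<delta> \<le> \<bar>x - c\<bar> \<Longrightarrow> cap \<delta> c x = 0"
  by (cases "\<bar>x - c\<bar> = \<delta>") (auto simp: cap_def indicator_def)

lemma cap_eq: "\<bar>x - c\<bar> \<le> \<delta> \<Longrightarrow> cap \<delta> c x = \<delta>\<^sup>2 - (x - c)\<^sup>2"
  by (auto simp: cap_def indicator_def)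

lemma cap_nonneg: "0 \<le> cap \<delta> c x"
proof (cases "\<bar>x - c\<bar> \<le> \<delta>")
  case True
  then have "(x - c)\<^sup>2 \<le> \<delta>\<^sup>2" by (simp flip: abs_le_square_iff)
  then show ?thesis using True by (simp add: cap_eq)
qed (simp add: cap_eq_0)

lemma cap_ge: "0 \<le> \<delta> \<Longrightarrow> \<delta>\<^sup>2 - (x - c)\<^sup>2 \<le> cap \<delta> c x"
proof (cases "\<bar>x - c\<bar> \<le> \<delta>")
  case False
  assume "0 \<le> \<delta>"
  with False have "\<delta>\<^sup>2 \<le> (x - c)\<^sup>2" by (simp flip: abs_le_square_iff)
  then show ?thesis using cap_nonneg[of \<delta> c x] by linarith
qed (simp add: cap_eq)

lemma has_bochner_integral_cap:
  assumes "0 \<le> \<delta>"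
  shows "has_bochner_integral lborel (cap \<delta> c) (4 * \<delta>^3 / 3)"
proof -
  let ?F = "\<lambda>x. \<delta>\<^sup>2 * x - (x - c)^3 / 3"
  have "has_bochner_integral lborel (\<lambda>x. (\<delta>\<^sup>2 - (x - c)\<^sup>2) * indicator {c - \<delta>..c + \<delta>} x)
      (?F (c + \<delta>) - ?F (c - \<delta>))"
    using assms
    by (intro has_bochner_integral_FTC_Icc_real)
       (auto intro!: derivative_eq_intros continuous_intros simp: field_simps)
  also have "?F (c + \<delta>) - ?F (c - \<delta>) = 4 * \<delta>^3 / 3"
    by (simp add: field_simps power2_eq_square power3_eq_cube)
  finally show ?thesis
    by (simp add: cap_def[abs_def] mult.commute)
qed

section \<open>Comparison of the squared distance with the caps\<close>

lemma continuous_on_Min_image: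
  fixes f :: "'c \<Rightarrow> 'a::topological_space \<Rightarrow> 'b::linorder_topology"
  assumes "finite A" "A \<noteq> {}" "\<And>c. c \<in> A \<Longrightarrow> continuous_on S (f c)"
  shows "continuous_on S (\<lambda>x. MIN c\<in>A. f c x)"
  using assms by (induction rule: finite_ne_induct) (auto intro: continuous_on_min)

lemma integrable_Min:
  fixes A :: "real set"
  assumes "finite A" "A \<noteq> {}"
  shows "integrable lborel (\<lambda>x. indicator {a..b} x * (MIN c\<in>A. (x - c)\<^sup>2))"
proof -
  have "set_integrable lborel {a..b} (\<lambda>x. MIN c\<in>A. (x - c)\<^sup>2)"
    using assms
    by (intro borel_integrable_atLeastAtMost' continuous_on_Min_image) (auto intro!: continuous_intros)
  then show ?thesis
    by (simp add: set_integrable_def)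
qed

lemma has_bochner_integral_caps:
  assumes "0 \<le> \<delta>" "a \<le> b"
  shows "has_bochner_integral lborel
           (\<lambda>x. indicator {a..b} x * \<delta>\<^sup>2 - (\<Sum>c\<in>A. cap \<delta> c x))
           ((b - a) * \<delta>\<^sup>2 - card A * (4 * \<delta>^3 / 3))"
proof -
  have "has_bochner_integral lborel (\<lambda>x. indicator {a..b} x * \<delta>\<^sup>2) (measure lborel {a..b} * \<delta>\<^sup>2)"
    using assms by (intro has_bochner_integral_mult_left has_bochner_integral_real_indicator) auto
  moreover have "has_bochner_integral lborel (\<lambda>x. \<Sum>c\<in>A. cap \<delta> c x) (\<Sum>c\<in>A. 4 * \<delta>^3 / 3)"
    by (intro has_bochner_integral_sum has_bochner_integral_cap assms)
  ultimately show ?thesis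
    using has_bochner_integral_diff assms by fastforce
qed

text \<open>
  On \<open>[a, b]\<close> the cap of a nearest centre already accounts for \<open>\<delta>\<^sup>2\<close> minus the squared distance;
  outside \<open>[a, b]\<close> the caps only help. No hypothesis on the position of the centres is made, which
  is what makes the bound applicable to every competitor \<open>A\<close>.
\<close>
lemma integral_Min_ge:
  fixes A :: "real set"
  assumes "finite A" "A \<noteq> {}" "0 \<le> \<delta>" "a \<le> b"
  shows "(b - a) * \<delta>\<^sup>2 - card A * (4 * \<delta>^3 / 3)
       \<le> (\<integral>x. indicator {a..b} x * (MIN c\<in>A. (x - c)\<^sup>2) \<partial>lborel)"
proof -
  note caps = has_bochner_integral_caps[OF assms(3,4), of A]
  have "indicator {a..b} x * \<delta>\<^sup>2 - (\<Sum>c\<in>A. cap \<delta> c x)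
      \<le> indicator {a..b} x * (MIN c\<in>A. (x - c)\<^sup>2)" for x
  proof -
    have "(MIN c\<in>A. (x - c)\<^sup>2) \<in> (\<lambda>c. (x - c)\<^sup>2) ` A"
      using assms by (intro Min_in) auto
    then obtain c where c: "c \<in> A" "(MIN c\<in>A. (x - c)\<^sup>2) = (x - c)\<^sup>2" by auto
    have "cap \<delta> c x \<le> (\<Sum>c\<in>A. cap \<delta> c x)"
      using c assms by (intro member_le_sum cap_nonneg) auto
    with cap_ge[of \<delta> x c] cap_nonneg[of \<delta> c x] c assms show ?thesis
      by (auto simp: indicator_def)
  qed
  then have "(\<integral>x. indicator {a..b} x * \<delta>\<^sup>2 - (\<Sum>c\<in>A. cap \<delta> c x) \<partial>lborel)
      \<le> (\<integral>x. indicator {a..b} x * (MIN c\<in>A. (x - c)\<^sup>2) \<partial>lborel)"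
    using assms caps by (intro integral_mono integrable_Min) (auto simp: has_bochner_integral_iff)
  then show ?thesis
    using has_bochner_integral_integral_eq[OF caps] by simp
qed

text \<open>
  The three geometric hypotheses say that the intervals of radius \<open>\<delta>\<close> around the centres tile
  \<open>[a, b]\<close>. Each makes one possible loss in the lower bound vanish: no cap sticks out of \<open>[a, b]\<close>,
  no two caps overlap, and no point of \<open>[a, b]\<close> is farther than \<open>\<delta>\<close> from \<open>A\<close>.
\<close>
lemma integral_Min_le:
  fixes A :: "real set"
  assumes "finite A" "A \<noteq> {}" "0 \<le> \<delta>" "a \<le> b"
    and inside: "\<And>c. c \<in> A \<Longrightarrow> a + \<delta> \<le> c \<and> c \<le> b - \<delta>"
    and separated: "\<And>c c'. c \<in> A \<Longrightarrow> c' \<in> A \<Longrightarrow> c \<noteq> c' \<Longrightarrow> 2 * \<delta> \<le> \<bar>c - c'\<bar>"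
    and covering: "\<And>x. x \<in> {a..b} \<Longrightarrow> \<exists>c\<in>A. \<bar>x - c\<bar> \<le> \<delta>"
  shows "(\<integral>x. indicator {a..b} x * (MIN c\<in>A. (x - c)\<^sup>2) \<partial>lborel)
       \<le> (b - a) * \<delta>\<^sup>2 - card A * (4 * \<delta>^3 / 3)"
proof -
  note caps = has_bochner_integral_caps[OF assms(3,4), of A]
  have "indicator {a..b} x * (MIN c\<in>A. (x - c)\<^sup>2)
      \<le> indicator {a..b} x * \<delta>\<^sup>2 - (\<Sum>c\<in>A. cap \<delta> c x)" for x
  proof (cases "x \<in> {a..b}")
    case True
    then obtain c where c: "c \<in> A" "\<bar>x - c\<bar> \<le> \<delta>" using covering by blast
    have "cap \<delta> c' x = 0" if "c' \<in> A - {c}" for c'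
      using separated[of c c'] c that by (intro cap_eq_0) auto
    then have "(\<Sum>c\<in>A. cap \<delta> c x) = \<delta>\<^sup>2 - (x - c)\<^sup>2"
      using c assms(1) by (simp add: sum.remove[of A c] cap_eq)
    moreover have "(MIN c\<in>A. (x - c)\<^sup>2) \<le> (x - c)\<^sup>2"
      using c assms(1) by (intro Min_le) auto
    ultimately show ?thesis using True by simp
  next
    case False
    have "cap \<delta> c x = 0" if "c \<in> A" for c
      using inside[OF that] False by (intro cap_eq_0) auto
    then show ?thesis using False by simp
  qed
  then have "(\<integral>x. indicator {a..b} x * (MIN c\<in>A. (x - c)\<^sup>2) \<partial>lborel)
      \<le> (\<integral>x. indicator {a..b} x * \<delta>\<^sup>2 - (\<Sum>c\<in>A. cap \<delta> c x) \<partial>lborel)"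
    using assms caps by (intro integral_mono integrable_Min) (auto simp: has_bochner_integral_iff)
  then show ?thesis
    using has_bochner_integral_integral_eq[OF caps] by simp
qed

section \<open>The quantization error of the uniform distribution\<close>

lemma distortion_uniform_interval:
  assumes "a < b" "finite A" "A \<noteq> {}"
  shows "distortion (uniform_interval a b) A =
    (\<integral>x. indicator {a..b} x * (MIN c\<in>A. (x - c)\<^sup>2) \<partial>lborel) / (b - a)"
proof -
  have [measurable]: "(\<lambda>x. MIN c\<in>A. (x - c)\<^sup>2) \<in> borel_measurable borel"
    using assms
    by (intro borel_measurable_continuous_onI continuous_on_Min_image) (auto intro!: continuous_intros)
  have "distortion (uniform_interval a b) A =
      (\<integral>x. (if x \<in> {a..b} then 1 / (b - a) else 0) * (MIN c\<in>A. (x - c)\<^sup>2) \<partial>lborel)"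
    unfolding distortion_def uniform_interval_def using assms(1)
    by (subst integral_real_density) (auto simp: power2_abs)
  also have "\<dots> = (\<integral>x. indicator {a..b} x * (MIN c\<in>A. (x - c)\<^sup>2) / (b - a) \<partial>lborel)"
    by (intro Bochner_Integration.integral_cong) (auto simp: indicator_def)
  finally show ?thesis by simp
qed

lemma distortion_uniform_interval_ge:
  assumes "a < b" "finite A" "1 \<le> card A" "card A \<le> n"
  shows "(b - a)\<^sup>2 / 12 / (real n)\<^sup>2 \<le> distortion (uniform_interval a b) A"
proof -
  define m where "m = real (card A)"
  have m: "1 \<le> m" "m \<le> real n" using assms by (auto simp: m_def)
  have A: "A \<noteq> {}" using assms by auto
  \<comment> \<open>The maximiser of \<open>(b - a) * \<delta>\<^sup>2 - m * (4 * \<delta>^3 / 3)\<close>, the bound that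
    \<open>integral_Min_ge\<close> gives.\<close>
  define \<delta> where "\<delta> = (b - a) / (2 * m)"
  have "(b - a)\<^sup>2 / 12 / (real n)\<^sup>2 \<le> (b - a)\<^sup>2 / 12 / m\<^sup>2"
    using m by (intro divide_left_mono power_mono mult_pos_pos zero_less_power) auto
  also have "\<dots> = ((b - a) * \<delta>\<^sup>2 - m * (4 * \<delta>^3 / 3)) / (b - a)"
    using m assms(1) unfolding \<delta>_def by (simp add: field_simps power2_eq_square power3_eq_cube)
  also have "\<dots> \<le> distortion (uniform_interval a b) A"
    unfolding distortion_uniform_interval[OF assms(1,2) A] m_def
    using assms A m by (intro divide_right_mono integral_Min_ge) (auto simp: \<delta>_def)
  finally show ?thesis .
qed

lemma distortion_uniform_interval_midpoints:
  fixes a b :: real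
  assumes "a < b" "1 \<le> n"
  defines "A \<equiv> (\<lambda>i. a + (2 * real i + 1) * ((b - a) / (2 * real n))) ` {..<n}"
  shows "card A = n" "distortion (uniform_interval a b) A \<le> (b - a)\<^sup>2 / 12 / (real n)\<^sup>2"
proof -
  define \<delta> where "\<delta> = (b - a) / (2 * real n)"
  have \<delta>: "0 < \<delta>" "b = a + 2 * real n * \<delta>" using assms by (auto simp: \<delta>_def)
  define f where "f i = a + (2 * real i + 1) * \<delta>" for i
  have Af: "A = f ` {..<n}" by (simp add: A_def f_def[abs_def] \<delta>_def)
  have sep: "2 * \<delta> \<le> \<bar>f i - f j\<bar>" if "i \<noteq> j" for i j
  proof -
    have "f i - f j = 2 * \<delta> * (real i - real j)" by (simp add: f_def algebra_simps)
    moreover have "1 \<le> \<bar>real i - real j\<bar>" using that by linarith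
    ultimately show ?thesis using \<delta> by (simp add: abs_mult)
  qed
  have separated: "2 * \<delta> \<le> \<bar>c - c'\<bar>" if "c \<in> A" "c' \<in> A" "c \<noteq> c'" for c c'
  proof -
    obtain i j where "c = f i" "c' = f j" using \<open>c \<in> A\<close> \<open>c' \<in> A\<close> by (auto simp: Af)
    then show ?thesis using sep[of i j] \<open>c \<noteq> c'\<close> by auto
  qed
  have "inj_on f {..<n}" using sep \<delta> by (force intro!: inj_onI)
  then show card: "card A = n" by (simp add: Af card_image)
  have A: "finite A" "A \<noteq> {}" using assms(2) by (auto simp: Af lessThan_empty_iff)
  have inside: "a + \<delta> \<le> c \<and> c \<le> b - \<delta>" if "c \<in> A" for c
  proof -
    obtain i where i: "i < n" "c = f i" using \<open>c \<in> A\<close> by (auto simp: Af)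
    have "(2 * real i + 2) * \<delta> \<le> 2 * real n * \<delta>" using i \<delta> by (intro mult_right_mono) auto
    moreover have "0 \<le> real i * \<delta>" using \<delta> by simp
    ultimately show ?thesis unfolding i f_def \<delta>(2) by (simp add: algebra_simps)
  qed
  have covering: "\<exists>c\<in>A. \<bar>x - c\<bar> \<le> \<delta>" if x: "x \<in> {a..b}" for x
  proof -
    define t where "t = (x - a) / (2 * \<delta>)"
    have xt: "x = a + 2 * t * \<delta>" using \<delta>(1) by (simp add: t_def field_simps)
    have t: "0 \<le> t" "t \<le> real n"
      using x \<delta>(1) unfolding t_def by (auto simp: \<delta>(2) field_simps)
    \<comment> \<open>At \<open>x = b\<close> the floor is \<open>n\<close>, and the last interval contains \<open>x\<close>.\<close>
    define i where "i = min (n - 1) (nat \<lfloor>t\<rfloor>)"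
    have i: "i < n" "real i \<le> t" "t \<le> real i + 1"
      using t assms(2) unfolding i_def by linarith+
    have "\<bar>2 * t - (2 * real i + 1)\<bar> * \<delta> \<le> 1 * \<delta>"
      using i \<delta> by (intro mult_right_mono) auto
    moreover have "x - f i = (2 * t - (2 * real i + 1)) * \<delta>"
      by (simp add: xt f_def algebra_simps)
    ultimately have "\<bar>x - f i\<bar> \<le> \<delta>" using \<delta> by (simp add: abs_mult)
    then show ?thesis using i by (auto simp: Af)
  qed
  have "distortion (uniform_interval a b) A
      \<le> ((b - a) * \<delta>\<^sup>2 - real (card A) * (4 * \<delta>^3 / 3)) / (b - a)"
    unfolding distortion_uniform_interval[OF assms(1) A]
    using assms(1) A \<delta>(1)
    by (intro divide_right_mono integral_Min_le inside separated covering) auto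
  also have "\<dots> = (b - a)\<^sup>2 / 12 / (real n)\<^sup>2"
    using assms(1,2) unfolding card \<delta>_def by (simp add: field_simps power2_eq_square power3_eq_cube)
  finally show "distortion (uniform_interval a b) A \<le> (b - a)\<^sup>2 / 12 / (real n)\<^sup>2" .
qed

lemma quantization_error_uniform_interval:
  fixes a b :: real
  assumes "a < b" "1 \<le> n"
  shows "quantization_error (uniform_interval a b) n = (b - a)\<^sup>2 / 12 / (real n)\<^sup>2"
  unfolding quantization_error_def
proof (rule cInf_eq_minimum)
  let ?A = "(\<lambda>i. a + (2 * real i + 1) * ((b - a) / (2 * real n))) ` {..<n}"
  note mid = distortion_uniform_interval_midpoints[OF assms]
  have "distortion (uniform_interval a b) ?A = (b - a)\<^sup>2 / 12 / (real n)\<^sup>2"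
    using mid assms by (intro antisym mid distortion_uniform_interval_ge) auto
  then show "(b - a)\<^sup>2 / 12 / (real n)\<^sup>2 \<in>
      {distortion (uniform_interval a b) A | A. finite A \<and> 1 \<le> card A \<and> card A \<le> n}"
    using mid(1) assms(2) by (intro CollectI exI[of _ ?A]) auto
qed (use distortion_uniform_interval_ge[OF assms(1)] in auto)

theorem mainTheorem5:
  fixes a b :: real and P :: "real measure"
  assumes "a < b" and "P = uniform_interval a b"
  shows "quantization_dimension_exists P
    \<and> quantization_dimension P = 1
    \<and> (\<lambda>n. 2 * ln (real n) / (- ln (quantization_error P n))) \<longlonglongrightarrow> 1
    \<and> (\<lambda>n. (real n)\<^sup>2 * quantization_error P n) \<longlonglongrightarrow> (a - b)\<^sup>2 / 12
    \<and> (a - b)\<^sup>2 / 12 > 0"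
proof -
  define C where "C = (b - a)\<^sup>2 / 12"
  have C: "C > 0" using assms(1) by (simp add: C_def)
  have C': "(a - b)\<^sup>2 / 12 = C" by (simp add: C_def power2_commute)
  have err: "\<forall>\<^sub>F n in sequentially. C / (real n)\<^sup>2 = quantization_error P n"
    using eventually_ge_at_top[of 1]
    by eventually_elim (simp add: assms quantization_error_uniform_interval C_def)
  have "(\<lambda>n. 2 * ln (real n) / (- ln (C / (real n)\<^sup>2))) \<longlonglongrightarrow> 1"
    using C by real_asymp
  then have ratio: "(\<lambda>n. 2 * ln (real n) / (- ln (quantization_error P n))) \<longlonglongrightarrow> 1"
    by (rule Lim_transform_eventually) (use err in eventually_elim, simp)
  have "(\<lambda>n. (real n)\<^sup>2 * (C / (real n)\<^sup>2)) \<longlonglongrightarrow> C"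
    by real_asymp
  then have coeff: "(\<lambda>n. (real n)\<^sup>2 * quantization_error P n) \<longlonglongrightarrow> C"
    by (rule Lim_transform_eventually) (use err in eventually_elim, simp)
  have "(\<lambda>n. ereal (quantization_ratio P n)) \<longlonglongrightarrow> 1"
    using ratio by (simp add: quantization_ratio_def one_ereal_def)
  then have "lower_quantization_dimension P = 1" "upper_quantization_dimension P = 1"
    unfolding lower_quantization_dimension_def upper_quantization_dimension_def
    by (simp_all add: lim_imp_Liminf lim_imp_Limsup)
  then show ?thesis
    using ratio coeff C unfolding C'
    by (simp add: quantization_dimension_exists_def quantization_dimension_def)
qed

end
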